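(* For integers $\ell,m,p$, let $\mathfrak a_{\ell,m,p}$ be the number of inversion sequences $\sigma\in\mathcal{I}_\ell(100,101)$ such that $\max(\sigma)=m$ and the value $m$ appears exactly once in $\sigma$, at position $p$. Then for all $n\geqslant 2$, $$|\mathcal{I}_n(100,101)|=\sum_{\ell=1}^{n}\sum_{m=0}^{\ell-1}\sum_{p=m+1}^{\ell}\mathfrak a_{\ell,m,p}.$$
   Context: For $n\in\mathbb N$, an inversion sequence of size $n$ is a sequence $\sigma=(\sigma_1,\dots,\sigma_n)\in\mathbb N^n$ with $\sigma_i<i$ for all $i$. An integer sequence contains a pattern $\rho$ (a finite integer sequence such as $100$ or $101$) if it has a subsequence order-isomorphic to $\rho$, and avoids $\rho$ otherwise. $\mathcal{I}_n(P)$ denotes the set of inversion sequences of size $n$ avoiding every pattern in the set $P$. $\max(\sigma)$ is the largest entry of $\sigma$. *)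

theory Defs
  imports Main "HOL-Library.Sublist"
begin

(* A sequence (s_1, ..., s_n) is the list s of length n, with s_i written as s ! (i - 1). *)

definition order_isomorphic :: "'a::linorder list \<Rightarrow> 'b::linorder list \<Rightarrow> bool" where
  "order_isomorphic xs ys \<longleftrightarrow>
     length xs = length ys \<and>
     (\<forall>i < length xs. \<forall>j < length xs. xs ! i < xs ! j \<longleftrightarrow> ys ! i < ys ! j)"

definition contains_pattern :: "'a::linorder list \<Rightarrow> 'b::linorder list \<Rightarrow> bool" where
  "contains_pattern s r \<longleftrightarrow> (\<exists>t. subseq t s \<and> order_isomorphic t r)"

definition inversion_sequence :: "nat \<Rightarrow> nat list \<Rightarrow> bool" where
  "inversion_sequence n s \<longleftrightarrow> length s = n \<and> (\<forall>i \<in> {1..n}. s ! (i - 1) < i)"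

definition inv_seqs_avoiding :: "nat \<Rightarrow> int list set \<Rightarrow> nat list set" where
  "inv_seqs_avoiding n P = {s. inversion_sequence n s \<and> (\<forall>r \<in> P. \<not> contains_pattern s r)}"

definition unique_max_count :: "nat \<Rightarrow> nat \<Rightarrow> nat \<Rightarrow> nat" where
  "unique_max_count l m p =
     card {s \<in> inv_seqs_avoiding l {[1,0,0], [1,0,1]}.
             Max (set s) = m \<and> count_list s m = 1 \<and> p \<in> {1..l} \<and> s ! (p - 1) = m}"

end

(* Avoiding 101 forces the occurrences of the maximum M to be consecutive.  Since M itself is
   below its first position, every later entry satisfies the inversion bound wherever it is
   shifted to.  Hence repeating the first occurrence of M is a bijection from the avoiders of size
   n onto those avoiders of size n + 1 in which the maximum is not unique, and the formula follows
   by induction on n. *)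
theory Submission
  imports Defs
begin

section \<open>Occurrences of 100 and 101 as explicit subsequences\<close>

lemma order_isomorphic_triple:
  "order_isomorphic [a, b, c] [x, y, z] \<longleftrightarrow>
     (a < b \<longleftrightarrow> x < y) \<and> (b < a \<longleftrightarrow> y < x) \<and>
     (a < c \<longleftrightarrow> x < z) \<and> (c < a \<longleftrightarrow> z < x) \<and>
     (b < c \<longleftrightarrow> y < z) \<and> (c < b \<longleftrightarrow> z < y)"
  by (auto simp: order_isomorphic_def All_less_Suc)

text \<open>Order isomorphism compares entries by \<open><\<close> only. Two positions where the
  pattern is equal carry entries with neither below the other, and linearity makes these
  equal.\<close>

lemma contains_pattern_100_iff:
  "contains_pattern s [1, 0, 0 :: int] \<longleftrightarrow> (\<exists>a b. b < a \<and> subseq [a, b, b] s)"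
proof
  assume "contains_pattern s [1, 0, 0 :: int]"
  then obtain t where t: "subseq t s" "order_isomorphic t [1, 0, 0 :: int]"
    unfolding contains_pattern_def by blast
  then obtain a b c where "t = [a, b, c]"
    by (auto simp: order_isomorphic_def length_Suc_conv)
  with t show "\<exists>a b. b < a \<and> subseq [a, b, b] s"
    by (auto simp: order_isomorphic_triple not_less dest: order.antisym)
next
  assume "\<exists>a b. b < a \<and> subseq [a, b, b] s"
  then obtain a b where "b < a" "subseq [a, b, b] s" by blast
  moreover from this have "order_isomorphic [a, b, b] [1, 0, 0 :: int]"
    by (simp add: order_isomorphic_triple)
  ultimately show "contains_pattern s [1, 0, 0 :: int]"
    unfolding contains_pattern_def by blast
qed

lemma contains_pattern_101_iff:
  "contains_pattern s [1, 0, 1 :: int] \<longleftrightarrow> (\<exists>a b. b < a \<and> subseq [a, b, a] s)"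
proof
  assume "contains_pattern s [1, 0, 1 :: int]"
  then obtain t where t: "subseq t s" "order_isomorphic t [1, 0, 1 :: int]"
    unfolding contains_pattern_def by blast
  then obtain a b c where "t = [a, b, c]"
    by (auto simp: order_isomorphic_def length_Suc_conv)
  with t show "\<exists>a b. b < a \<and> subseq [a, b, a] s"
    by (auto simp: order_isomorphic_triple not_less dest: order.antisym)
next
  assume "\<exists>a b. b < a \<and> subseq [a, b, a] s"
  then obtain a b where "b < a" "subseq [a, b, a] s" by blast
  moreover from this have "order_isomorphic [a, b, a] [1, 0, 1 :: int]"
    by (simp add: order_isomorphic_triple)
  ultimately show "contains_pattern s [1, 0, 1 :: int]"
    unfolding contains_pattern_def by blast
qed

section \<open>The inversion bound around a largest entry\<close>

lemma inversion_sequence_iff: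
  "inversion_sequence n s \<longleftrightarrow> length s = n \<and> (\<forall>i < n. s ! i \<le> i)"
proof -
  \<comment> \<open>List index \<open>i\<close> holds the entry at position \<open>i + 1\<close>, so
    reindexing along \<open>Suc\<close> turns the strict bound into \<le>.\<close>
  have "(\<forall>i \<in> {1..n}. s ! (i - 1) < i) \<longleftrightarrow> (\<forall>i \<in> Suc ` {..<n}. s ! (i - 1) < i)"
    by (simp add: image_Suc_lessThan)
  also have "\<dots> \<longleftrightarrow> (\<forall>i < n. s ! i \<le> i)"
    by (auto simp: less_Suc_eq_le)
  finally show ?thesis
    by (simp add: inversion_sequence_def)
qed

text \<open>Entries of \<open>ys\<close> are at most \<open>M\<close> and sit at indices beyond
  \<open>length xs\<close>, so the bound on \<open>M\<close> implies theirs. The right side sees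
  \<open>ys\<close> only through its length, so shifting \<open>ys\<close> by one place is
  harmless.\<close>

lemma inversion_sequence_append_max_iff:
  assumes "\<forall>y \<in> set ys. y \<le> M"
  shows "inversion_sequence n (xs @ M # ys) \<longleftrightarrow>
    n = length xs + Suc (length ys) \<and> (\<forall>i < length xs. xs ! i \<le> i) \<and> M \<le> length xs"
    (is "?L \<longleftrightarrow> ?R")
proof
  assume L: ?L
  hence *: "(xs @ M # ys) ! i \<le> i" if "i < length xs + Suc (length ys)" for i
    using that by (auto simp: inversion_sequence_iff)
  have "xs ! i \<le> i" if "i < length xs" for i
    using *[of i] that by (simp add: nth_append)
  moreover have "M \<le> length xs"
    using *[of "length xs"] by simp
  ultimately show ?R
    using L by (auto simp: inversion_sequence_iff)
next
  assume R: ?R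
  have "(xs @ M # ys) ! i \<le> i" if "i < n" for i
  proof (cases "i < length xs")
    case True
    with R show ?thesis by (simp add: nth_append)
  next
    case False
    hence "(xs @ M # ys) ! i \<in> set (M # ys)"
      using R that nth_mem[of "i - length xs" "M # ys"] by (simp add: nth_append)
    hence "(xs @ M # ys) ! i \<le> M"
      using assms by auto
    with R False show ?thesis by linarith
  qed
  with R show ?L by (simp add: inversion_sequence_iff)
qed

lemma subseq_remove_duplicate:
  assumes "subseq zs (xs @ M # M # ys)" and "\<And>us vs. zs \<noteq> us @ M # M # vs"
  shows "subseq zs (xs @ M # ys)"
proof -
  obtain us vs where zs: "zs = us @ vs" "subseq us xs" "subseq vs (M # M # ys)"
    using assms(1) unfolding subseq_append_iff by blast
  have "subseq vs (M # ys)"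
  proof (cases vs)
    case (Cons v vs')
    show ?thesis
    proof (cases "v = M")
      case True
      hence "subseq vs' (M # ys)" using zs(3) Cons by simp
      moreover have "\<nexists>ws. vs' = M # ws" using assms(2) zs(1) Cons True by blast
      ultimately have "subseq vs' ys"
        by (cases vs') (auto split: if_splits)
      thus ?thesis using Cons True by simp
    next
      case False
      thus ?thesis using zs(3) Cons by simp
    qed
  qed simp
  with zs show ?thesis by (simp add: list_emb_append_mono)
qed

section \<open>Avoiders and the repetition of a maximum\<close>

definition avoiders :: "nat \<Rightarrow> nat list set" where
  "avoiders n = inv_seqs_avoiding n {[1, 0, 0], [1, 0, 1]}"

lemma avoiders_iff:
  "s \<in> avoiders n \<longleftrightarrow> inversion_sequence n s \<and>
     (\<forall>a b. b < a \<longrightarrow> \<not> subseq [a, b, b] s \<and> \<not> subseq [a, b, a] s)"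
  unfolding avoiders_def inv_seqs_avoiding_def
  by (auto simp: contains_pattern_100_iff contains_pattern_101_iff)

lemma length_avoiders: "s \<in> avoiders n \<Longrightarrow> length s = n"
  by (simp add: avoiders_iff inversion_sequence_iff)

lemma finite_avoiders: "finite (avoiders n)"
proof (rule finite_subset)
  show "avoiders n \<subseteq> {s. set s \<subseteq> {..n} \<and> length s = n}"
    by (fastforce simp: avoiders_iff inversion_sequence_iff in_set_conv_nth)
  show "finite {s. set s \<subseteq> {..n} \<and> length s = n}"
    by (rule finite_lists_length_eq) simp
qed

text \<open>The inversion condition does not change when the entries after \<open>M\<close> shift,
  and no occurrence of either pattern needs both copies of \<open>M\<close>.\<close>

lemma avoiders_duplicate_max_iff:
  assumes "\<forall>x \<in> set xs. x < M" and "\<forall>y \<in> set ys. y \<le> M"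
  shows "xs @ M # M # ys \<in> avoiders (Suc n) \<longleftrightarrow> xs @ M # ys \<in> avoiders n"
proof -
  have inv: "inversion_sequence (Suc n) (xs @ M # M # ys) \<longleftrightarrow> inversion_sequence n (xs @ M # ys)"
    using assms(2) by (auto simp: inversion_sequence_append_max_iff)
  have sub: "subseq [a, b, c] (xs @ M # M # ys) \<longleftrightarrow> subseq [a, b, c] (xs @ M # ys)"
    if "b < a" "c = a \<or> c = b" for a b c
  proof
    assume *: "subseq [a, b, c] (xs @ M # M # ys)"
    hence "a \<in> set (xs @ M # M # ys)"
      by (auto dest: list_emb_set[where x = a])
    \<comment> \<open>Any two adjacent letters of \<open>[a, b, c]\<close> include the middle one,
      so \<open>b < M\<close> rules out two adjacent copies of \<open>M\<close>.\<close>
    hence "b < M" using assms that(1) by auto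
    hence "[a, b, c] \<noteq> us @ M # M # vs" for us vs
      using that by (auto simp: append_eq_Cons_conv Cons_eq_append_conv)
    with * show "subseq [a, b, c] (xs @ M # ys)"
      by (rule subseq_remove_duplicate)
  next
    assume "subseq [a, b, c] (xs @ M # ys)"
    moreover have "subseq (xs @ M # ys) (xs @ M # M # ys)"
      by (intro list_emb_append_mono list_emb_Cons subseq_order.refl)
    ultimately show "subseq [a, b, c] (xs @ M # M # ys)"
      using subseq_order.trans by blast
  qed
  show ?thesis
    unfolding avoiders_iff inv using sub by blast
qed

section \<open>Duplication of the first maximum as a bijection\<close>

lemma obtain_first_max:
  fixes s :: "nat list"
  assumes "s \<noteq> []"
  obtains xs ys where "s = xs @ Max (set s) # ys"
    "\<forall>x \<in> set xs. x < Max (set s)" "\<forall>y \<in> set ys. y \<le> Max (set s)"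
proof -
  define M where "M = Max (set s)"
  have "M \<in> set s" using assms by (simp add: M_def)
  \<comment> \<open>Choosing the first occurrence makes every entry of \<open>xs\<close> strictly
    smaller than \<open>M\<close>, which determines the split uniquely.\<close>
  then obtain xs ys where s: "s = xs @ M # ys" "M \<notin> set xs"
    by (meson split_list_first)
  have le: "x \<le> M" if "x \<in> set s" for x using that by (simp add: M_def)
  have "x < M" if "x \<in> set xs" for x
    using le[of x] s that by (auto simp: order.strict_iff_order)
  moreover have "y \<le> M" if "y \<in> set ys" for y
    using le[of y] s(1) that by simp
  ultimately show thesis using s(1) that unfolding M_def by blast
qed

text \<open>For nonempty \<open>s\<close> the \<open>dropWhile\<close> part still begins with the
  first occurrence of \<open>M\<close>, so the inserted \<open>M\<close> is an additional
  copy.\<close>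

definition duplicate_max :: "nat list \<Rightarrow> nat list" where
  "duplicate_max s = (let M = Max (set s) in
     takeWhile (\<lambda>x. x \<noteq> M) s @ M # dropWhile (\<lambda>x. x \<noteq> M) s)"

lemma Max_set_append_max:
  fixes M :: nat
  assumes "\<forall>x \<in> set xs. x < M" and "\<forall>y \<in> set ys. y \<le> M"
  shows "Max (set (xs @ M # ys)) = M"
  by (rule Max_eqI) (use assms in auto)

lemma duplicate_max_append:
  assumes "\<forall>x \<in> set xs. x < M" and "\<forall>y \<in> set ys. y \<le> M"
  shows "duplicate_max (xs @ M # ys) = xs @ M # M # ys"
proof -
  have "takeWhile (\<lambda>x. x \<noteq> M) (xs @ M # ys) = xs" "dropWhile (\<lambda>x. x \<noteq> M) (xs @ M # ys) = M # ys"
    using assms(1) by (auto simp: takeWhile_append dropWhile_append)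
  thus ?thesis
    unfolding duplicate_max_def Max_set_append_max[OF assms] by simp
qed

definition unique_max_avoiders :: "nat \<Rightarrow> nat list set" where
  "unique_max_avoiders n = {s \<in> avoiders n. count_list s (Max (set s)) = 1}"

text \<open>The image keeps the maximum and the prefix before it, which gives injectivity. For
  surjectivity, avoiding 101 makes a repeated maximum reappear directly after its first occurrence,
  where one copy can be deleted. The bound on \<open>n\<close> excludes the empty sequence, which
  has no maximum.\<close>

lemma bij_betw_duplicate_max:
  assumes "n \<ge> 1"
  shows "bij_betw duplicate_max (avoiders n) (avoiders (Suc n) - unique_max_avoiders (Suc n))"
  unfolding bij_betw_def
proof
  have nonempty: "s \<noteq> []" if "s \<in> avoiders n" for s
    using that assms length_avoiders by fastforce
  have Max_duplicate: "Max (set (duplicate_max s)) = Max (set s)" if "s \<noteq> []" for s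
  proof -
    obtain xs ys where s: "s = xs @ Max (set s) # ys"
      "\<forall>x \<in> set xs. x < Max (set s)" "\<forall>y \<in> set ys. y \<le> Max (set s)"
      using obtain_first_max[OF \<open>s \<noteq> []\<close>] .
    have "duplicate_max s = xs @ Max (set s) # Max (set s) # ys"
      using duplicate_max_append[OF s(2,3)] s(1) by simp
    thus ?thesis using Max_set_append_max[of xs "Max (set s)" "Max (set s) # ys"] s(2,3) by simp
  qed
  show "inj_on duplicate_max (avoiders n)"
  proof (rule inj_onI)
    fix s t assume st: "s \<in> avoiders n" "t \<in> avoiders n" "duplicate_max s = duplicate_max t"
    define M where "M = Max (set s)"
    have M: "Max (set t) = M"
      using Max_duplicate nonempty st unfolding M_def by metis
    obtain xs ys where s: "s = xs @ M # ys" "\<forall>x \<in> set xs. x < M" "\<forall>y \<in> set ys. y \<le> M"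
      using obtain_first_max[OF nonempty[OF st(1)]] unfolding M_def .
    obtain us vs where t: "t = us @ M # vs" "\<forall>x \<in> set us. x < M" "\<forall>y \<in> set vs. y \<le> M"
      using obtain_first_max[OF nonempty[OF st(2)]] unfolding M .
    have eq: "xs @ M # M # ys = us @ M # M # vs"
      using st(3) s t by (simp add: duplicate_max_append)
    \<comment> \<open>Each prefix is recovered as the longest one with all entries below
      \<open>M\<close>.\<close>
    have "takeWhile (\<lambda>x. x < M) (xs @ M # M # ys) = takeWhile (\<lambda>x. x < M) (us @ M # M # vs)"
      unfolding eq ..
    hence "xs = us" using s(2) t(2) by simp
    with eq show "s = t" unfolding s(1) t(1) by simp
  qed
  show "duplicate_max ` avoiders n = avoiders (Suc n) - unique_max_avoiders (Suc n)"
  proof (intro equalityI subsetI)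
    fix t assume "t \<in> duplicate_max ` avoiders n"
    then obtain s where s: "s \<in> avoiders n" "t = duplicate_max s" by blast
    define M where "M = Max (set s)"
    obtain xs ys where d: "s = xs @ M # ys" "\<forall>x \<in> set xs. x < M" "\<forall>y \<in> set ys. y \<le> M"
      using obtain_first_max[OF nonempty[OF s(1)]] unfolding M_def .
    have t: "t = xs @ M # M # ys"
      using s(2) d by (simp add: duplicate_max_append)
    have "Max (set t) = M"
      using Max_duplicate[OF nonempty[OF s(1)]] s(2) M_def by simp
    hence "t \<notin> unique_max_avoiders (Suc n)"
      unfolding unique_max_avoiders_def t by simp
    moreover have "t \<in> avoiders (Suc n)"
      using s(1) d t avoiders_duplicate_max_iff by simp
    ultimately show "t \<in> avoiders (Suc n) - unique_max_avoiders (Suc n)" by blast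
  next
    fix t assume t: "t \<in> avoiders (Suc n) - unique_max_avoiders (Suc n)"
    define M where "M = Max (set t)"
    have "t \<noteq> []" using t length_avoiders by fastforce
    obtain xs ys where d: "t = xs @ M # ys" "\<forall>x \<in> set xs. x < M" "\<forall>y \<in> set ys. y \<le> M"
      using obtain_first_max[OF \<open>t \<noteq> []\<close>] unfolding M_def .
    \<comment> \<open>The prefix contributes no copy of \<open>M\<close>, so a further copy must lie
      in \<open>ys\<close>.\<close>
    have "count_list xs M = 0" using d(2) by (auto simp: count_list_0_iff)
    moreover have "count_list t M \<noteq> 1"
      using t unfolding unique_max_avoiders_def M_def by blast
    ultimately have "M \<in> set ys"
      by (auto simp: d(1) count_list_0_iff)
    then obtain y zs where ys: "ys = y # zs" by (cases ys) auto
    \<comment> \<open>Otherwise \<open>y < M\<close>, and the further copy of \<open>M\<close> lies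
      in \<open>zs\<close>; then \<open>M\<close>, \<open>y\<close>, \<open>M\<close> is an
      occurrence of 101.\<close>
    have "y = M"
    proof (rule ccontr)
      assume "y \<noteq> M"
      hence "y < M" "M \<in> set zs" using d(3) ys \<open>M \<in> set ys\<close> by auto
      hence "subseq [M, y, M] t"
        unfolding d(1) ys by (intro subseq_drop_many) (simp add: subseq_singleton_left)
      with t \<open>y < M\<close> show False by (auto simp: avoiders_iff)
    qed
    have zs: "\<forall>y \<in> set zs. y \<le> M" using d(3) ys by simp
    have "xs @ M # zs \<in> avoiders n"
      using t d(1,2) zs ys \<open>y = M\<close> avoiders_duplicate_max_iff by simp
    moreover have "t = duplicate_max (xs @ M # zs)"
      using d(1,2) zs ys \<open>y = M\<close> by (simp add: duplicate_max_append)
    ultimately show "t \<in> duplicate_max ` avoiders n" by blast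
  qed
qed

section \<open>Recursion in the size and its summation\<close>

lemma card_avoiders_Suc:
  assumes "n \<ge> 1"
  shows "card (avoiders (Suc n)) = card (avoiders n) + card (unique_max_avoiders (Suc n))"
proof -
  have sub: "unique_max_avoiders (Suc n) \<subseteq> avoiders (Suc n)"
    by (auto simp: unique_max_avoiders_def)
  have "card (avoiders n) = card (avoiders (Suc n) - unique_max_avoiders (Suc n))"
    using bij_betw_duplicate_max[OF assms] by (rule bij_betw_same_card)
  also have "\<dots> = card (avoiders (Suc n)) - card (unique_max_avoiders (Suc n))"
    using sub finite_avoiders by (intro card_Diff_subset) (auto intro: finite_subset)
  finally show ?thesis
    using card_mono[OF finite_avoiders sub] by simp
qed

text \<open>A single entry is its own unique maximum; this starts the summation at size 1.\<close>

lemma avoiders_1: "avoiders 1 = unique_max_avoiders 1"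
proof -
  have "count_list s (Max (set s)) = 1" if "s \<in> avoiders 1" for s
    using length_avoiders[OF that] by (auto simp: length_Suc_conv)
  thus ?thesis by (auto simp: unique_max_avoiders_def)
qed

lemma card_avoiders:
  assumes "n \<ge> 1"
  shows "card (avoiders n) = (\<Sum>l = 1..n. card (unique_max_avoiders l))"
  using assms
proof (induction n rule: nat_induct_at_least)
  case base
  show ?case using avoiders_1 by simp
next
  case (Suc n)
  thus ?case by (simp add: card_avoiders_Suc)
qed

section \<open>Sorting by the value and position of the unique maximum\<close>

lemma count_list_eq_1_nth_unique:
  assumes "count_list s x = 1" "i < length s" "j < length s" "s ! i = x" "s ! j = x"
  shows "i = j"
proof -
  \<comment> \<open>The count of \<open>x\<close> is the number of indices holding \<open>x\<close>,
    so these indices form a singleton.\<close>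
  have "card {k. k < length s \<and> s ! k = x} = 1"
    using assms(1)
    by (simp add: count_list_eq_length_filter length_filter_conv_card eq_commute[of x])
  then obtain k where "{k. k < length s \<and> s ! k = x} = {k}"
    by (rule card_1_singletonE)
  moreover have "i \<in> {k. k < length s \<and> s ! k = x}" "j \<in> {k. k < length s \<and> s ! k = x}"
    using assms(2-5) by simp_all
  ultimately show ?thesis by simp
qed

text \<open>A sequence determines its maximum \<open>m\<close> and, since \<open>m\<close> occurs
  once, its position \<open>p\<close>. The classes are therefore disjoint, and the inversion bound
  \<open>m < p\<close> confines the pairs to the stated triangle.\<close>

lemma card_unique_max_avoiders:
  assumes "l \<ge> 1"
  shows "card (unique_max_avoiders l) = (\<Sum>m = 0..l - 1. \<Sum>p = m + 1..l. unique_max_count l m p)"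
proof -
  define F where "F = (\<lambda>(m, p). {s \<in> avoiders l. Max (set s) = m \<and> count_list s m = 1 \<and>
    p \<in> {1..l} \<and> s ! (p - 1) = m})"
  define I where "I = (SIGMA m:{0..l - 1}. {m + 1..l})"
  have "unique_max_avoiders l = (\<Union>x \<in> I. F x)"
  proof (intro equalityI subsetI)
    fix s assume s: "s \<in> unique_max_avoiders l"
    define M where "M = Max (set s)"
    have len: "length s = l" and bound: "\<And>i. i < l \<Longrightarrow> s ! i \<le> i"
      using s by (auto simp: unique_max_avoiders_def avoiders_iff inversion_sequence_iff)
    have "M \<in> set s" using len assms unfolding M_def by (intro Max_in) auto
    then obtain i where i: "i < l" "s ! i = M"
      using len by (auto simp: in_set_conv_nth)
    \<comment> \<open>Index \<open>i\<close> is position \<open>Suc i\<close>. The bound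
      \<open>M \<le> i\<close> with \<open>i < l\<close> yields both
      \<open>M + 1 \<le> Suc i\<close> and \<open>M \<le> l - 1\<close>.\<close>
    have "(M, Suc i) \<in> I" "s \<in> F (M, Suc i)"
      using i bound[of i] s
      by (auto simp: I_def F_def M_def unique_max_avoiders_def)
    thus "s \<in> (\<Union>x \<in> I. F x)" by blast
  qed (auto simp: F_def unique_max_avoiders_def)
  moreover have "F x \<inter> F y = {}" if "x \<noteq> y" for x y
  proof (rule ccontr)
    obtain m p m' p' where xy: "x = (m, p)" "y = (m', p')" by fastforce
    assume "F x \<inter> F y \<noteq> {}"
    then obtain s where s: "s \<in> F x" "s \<in> F y" by blast
    have F: "s \<in> avoiders l" "Max (set s) = m" "count_list s m = 1" "p \<in> {1..l}" "s ! (p - 1) = m"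
      and F': "Max (set s) = m'" "p' \<in> {1..l}" "s ! (p' - 1) = m'"
      using s unfolding F_def xy by blast+
    have "m = m'" using F(2) F'(1) by (rule trans[OF sym])
    moreover have "p - 1 = p' - 1"
    proof (rule count_list_eq_1_nth_unique[OF F(3)])
      show "p - 1 < length s" "p' - 1 < length s"
        using F(4) F'(2) length_avoiders[OF F(1)] by auto
      show "s ! (p - 1) = m" "s ! (p' - 1) = m" using F(5) F'(3) \<open>m = m'\<close> by blast+
    qed
    \<comment> \<open>Both positions are at least 1, so truncated subtraction loses nothing.\<close>
    hence "p = p'" using F(4) F'(2) by auto
    ultimately show False using that xy by blast
  qed
  moreover have "finite (F x)" for x
    by (rule finite_subset[OF _ finite_avoiders[of l]]) (auto simp: F_def)
  ultimately have "card (unique_max_avoiders l) = (\<Sum>x \<in> I. card (F x))"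
    by (simp add: card_UN_disjoint I_def)
  also have "\<dots> = (\<Sum>(m, p) \<in> I. unique_max_count l m p)"
    by (simp add: F_def unique_max_count_def avoiders_def split_beta)
  also have "\<dots> = (\<Sum>m = 0..l - 1. \<Sum>p = m + 1..l. unique_max_count l m p)"
    unfolding I_def by (rule sum.Sigma[symmetric]) auto
  finally show ?thesis .
qed

theorem theorem7:
  fixes n :: nat
  assumes "n \<ge> 2"
  shows "card (inv_seqs_avoiding n {[1,0,0], [1,0,1]}) =
           (\<Sum>l = 1..n. \<Sum>m = 0..l - 1. \<Sum>p = m + 1..l. unique_max_count l m p)"
proof -
  have "card (avoiders n) = (\<Sum>l = 1..n. card (unique_max_avoiders l))"
    using assms by (intro card_avoiders) simp
  also have "\<dots> = (\<Sum>l = 1..n. \<Sum>m = 0..l - 1. \<Sum>p = m + 1..l. unique_max_count l m p)"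
    by (intro sum.cong refl card_unique_max_avoiders) simp
  finally show ?thesis
    by (simp only: avoiders_def)
qed

end
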